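(* For every $n\ge 2$ and every $a\in\Bbbk^\times$, the $n$-dimensional $\mathcal{B}$-module $\mathcal{V}_a$ is indecomposable.
   Context: $\Bbbk$ is an algebraically closed field of characteristic $0$. The super Jordan plane $\mathcal{B}$ is the associative unital $\Bbbk$-algebra generated by $x_1,x_2$ with defining relations $x_1^2=0$ and $x_2x_{21}=x_{21}x_2+x_1x_{21}$, where $x_{21}:=x_1x_2+x_2x_1$. For $n\ge2$ and $a\in\Bbbk^\times$, $\mathcal{V}_a$ is the $\mathcal{B}$-module with basis $v_1,\ldots,v_n$ and action: $x_1v_2=v_1$ and $x_1v_i=0$ for $i\neq2$; $x_2v_1=av_1$, $x_2v_i=-av_i+v_{i+1}$ for $2\le i\le n-1$, and $x_2v_n=-av_n$. *)

theory Defs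
  imports
    "HOL-Library.Poly_Mapping"
    "HOL-Computational_Algebra.Polynomial"
    "HOL-Algebra.Algebra"
    "HOL-Algebra.Algebraic_Closure_Type"
begin

section \<open>Left modules over a (not necessarily commutative) ring\<close>

text \<open>The locale \<^locale>\<open>module\<close> of HOL-Algebra requires the scalar ring to be commutative;
  the following is the same locale over an arbitrary ring.  The record type of modules and
  the locale \<^locale>\<open>submodule\<close> do not mention commutativity and are used as they are.\<close>

locale left_module = R?: ring R + M?: abelian_group M
  for R :: "('r, 's) ring_scheme" and M :: "('r, 'm, 't) module_scheme" (structure) +
  assumes smult_closed:
      "\<lbrakk>a \<in> carrier R; x \<in> carrier M\<rbrakk> \<Longrightarrow> a \<odot>\<^bsub>M\<^esub> x \<in> carrier M"
    and smult_l_distr: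
      "\<lbrakk>a \<in> carrier R; b \<in> carrier R; x \<in> carrier M\<rbrakk> \<Longrightarrow>
        (a \<oplus>\<^bsub>R\<^esub> b) \<odot>\<^bsub>M\<^esub> x = a \<odot>\<^bsub>M\<^esub> x \<oplus>\<^bsub>M\<^esub> b \<odot>\<^bsub>M\<^esub> x"
    and smult_r_distr:
      "\<lbrakk>a \<in> carrier R; x \<in> carrier M; y \<in> carrier M\<rbrakk> \<Longrightarrow>
        a \<odot>\<^bsub>M\<^esub> (x \<oplus>\<^bsub>M\<^esub> y) = a \<odot>\<^bsub>M\<^esub> x \<oplus>\<^bsub>M\<^esub> a \<odot>\<^bsub>M\<^esub> y"
    and smult_assoc1:
      "\<lbrakk>a \<in> carrier R; b \<in> carrier R; x \<in> carrier M\<rbrakk> \<Longrightarrow>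
        (a \<otimes>\<^bsub>R\<^esub> b) \<odot>\<^bsub>M\<^esub> x = a \<odot>\<^bsub>M\<^esub> (b \<odot>\<^bsub>M\<^esub> x)"
    and smult_one: "x \<in> carrier M \<Longrightarrow> \<one>\<^bsub>R\<^esub> \<odot>\<^bsub>M\<^esub> x = x"

definition indecomposable_module :: "('r, 's) ring_scheme \<Rightarrow> ('r, 'm, 't) module_scheme \<Rightarrow> bool"
  where "indecomposable_module R M \<longleftrightarrow>
    carrier M \<noteq> {\<zero>\<^bsub>M\<^esub>} \<and>
    (\<forall>U W. submodule U R M \<longrightarrow> submodule W R M \<longrightarrow>
       U <+>\<^bsub>M\<^esub> W = carrier M \<longrightarrow> U \<inter> W = {\<zero>\<^bsub>M\<^esub>} \<longrightarrow>
       U = {\<zero>\<^bsub>M\<^esub>} \<or> W = {\<zero>\<^bsub>M\<^esub>})"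

section \<open>The free algebra on two generators\<close>

text \<open>Words form the free monoid, written additively because multiplication of
  \<^typ>\<open>'w \<Rightarrow>\<^sub>0 'k\<close> is convolution with respect to the additive monoid on \<^typ>\<open>'w\<close>.\<close>

datatype gen = X1 | X2

datatype word = Word (letters: "gen list")

instantiation word :: monoid_add
begin

definition zero_word :: word where "0 = Word []"

definition plus_word :: "word \<Rightarrow> word \<Rightarrow> word" where
  "u + v = Word (letters u @ letters v)"

instance by standard (auto simp: zero_word_def plus_word_def)

end

type_synonym 'k free_alg = "word \<Rightarrow>\<^sub>0 'k"

definition free_gen :: "gen \<Rightarrow> 'k::field free_alg" where
  "free_gen g = Poly_Mapping.single (Word [g]) 1"

abbreviation free_ring :: "'k::field free_alg ring" where
  "free_ring \<equiv> ring_of_type_algebra"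

section \<open>The super Jordan plane\<close>

definition sjp_relators :: "'k::field free_alg set" where
  "sjp_relators =
    (let x1 = free_gen X1; x2 = free_gen X2; x21 = x1 * x2 + x2 * x1
     in {x1 * x1, x2 * x21 - (x21 * x2 + x1 * x21)})"

text \<open>\<^const>\<open>genideal\<close> is the two-sided ideal generated by a set.\<close>

definition sjp_ideal :: "'k::field free_alg set" where
  "sjp_ideal = Idl\<^bsub>free_ring\<^esub> sjp_relators"

definition sjp :: "'k::field free_alg set ring" where
  "sjp = free_ring Quot sjp_ideal"

definition sjp_class :: "'k::field free_alg \<Rightarrow> 'k free_alg set" where
  "sjp_class f = sjp_ideal +>\<^bsub>free_ring\<^esub> f"

definition sjp_gen :: "gen \<Rightarrow> 'k::field free_alg set" where
  "sjp_gen g = sjp_class (free_gen g)"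

text \<open>The structure map from the ground field, by which every module over the super Jordan
  plane is a vector space.\<close>

definition sjp_scalar :: "'k::field \<Rightarrow> 'k free_alg set" where
  "sjp_scalar c = sjp_class (Poly_Mapping.single 0 c)"

definition is_k_basis ::
  "('k::field free_alg set, 'm, 't) module_scheme \<Rightarrow> nat \<Rightarrow> (nat \<Rightarrow> 'm) \<Rightarrow> bool" where
  "is_k_basis M n v \<longleftrightarrow>
    v \<in> {1..n} \<rightarrow> carrier M \<and>
    (\<forall>m \<in> carrier M. \<exists>!c. c \<in> {1..n} \<rightarrow>\<^sub>E UNIV \<and>
       m = (\<Oplus>\<^bsub>M\<^esub>i\<in>{1..n}. sjp_scalar (c i) \<odot>\<^bsub>M\<^esub> v i))"

section \<open>The modules \<open>V_a\<close>\<close>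

text \<open>Vectors are coordinate functions vanishing outside \<open>{1..n}\<close>.\<close>

definition vb :: "nat \<Rightarrow> nat \<Rightarrow> 'k::field" where
  "vb i = (\<lambda>j. if j = i then 1 else 0)"

fun gen_on_basis :: "nat \<Rightarrow> 'k::field \<Rightarrow> gen \<Rightarrow> nat \<Rightarrow> (nat \<Rightarrow> 'k)" where
  "gen_on_basis n a X1 i = (if i = 2 then vb 1 else (\<lambda>j. 0))"
| "gen_on_basis n a X2 i =
    (if i = 1 then (\<lambda>j. a * vb 1 j)
     else if i < n then (\<lambda>j. - a * vb i j + vb (i + 1) j)
     else (\<lambda>j. - a * vb n j))"

definition gen_act :: "nat \<Rightarrow> 'k::field \<Rightarrow> gen \<Rightarrow> (nat \<Rightarrow> 'k) \<Rightarrow> (nat \<Rightarrow> 'k)" where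
  "gen_act n a g v = (\<lambda>j. \<Sum>i=1..n. v i * gen_on_basis n a g i j)"

definition word_act :: "nat \<Rightarrow> 'k::field \<Rightarrow> word \<Rightarrow> (nat \<Rightarrow> 'k) \<Rightarrow> (nat \<Rightarrow> 'k)" where
  "word_act n a w v = foldr (gen_act n a) (letters w) v"

definition free_act :: "nat \<Rightarrow> 'k::field \<Rightarrow> 'k free_alg \<Rightarrow> (nat \<Rightarrow> 'k) \<Rightarrow> (nat \<Rightarrow> 'k)" where
  "free_act n a f v =
    (\<lambda>j. \<Sum>w\<in>Poly_Mapping.keys f. Poly_Mapping.lookup f w * word_act n a w v j)"

text \<open>A class acts through any of its representatives; independence of the choice is
  \<open>Va_smult_class\<close> below, and \<open>Va_smult_gen_basis\<close> computes the generators on the basis.  The fields \<open>mult\<close> and \<open>one\<close> are irrelevant for modules.\<close>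

definition Va :: "nat \<Rightarrow> 'k::field \<Rightarrow> ('k free_alg set, nat \<Rightarrow> 'k) module" where
  "Va n a = \<lparr>carrier = {v. \<forall>i. i \<notin> {1..n} \<longrightarrow> v i = 0},
     monoid.mult = undefined, one = undefined,
     ring.zero = (\<lambda>i. 0), add = (\<lambda>v w i. v i + w i),
     module.smult = (\<lambda>x v. the_elem ((\<lambda>f. free_act n a f v) ` x))\<rparr>"

section \<open>Well-definedness\<close>

lemma free_ring_simps [simp]:
  "carrier free_ring = UNIV" "x \<otimes>\<^bsub>free_ring\<^esub> y = x * y" "x \<oplus>\<^bsub>free_ring\<^esub> y = x + y"
  "\<one>\<^bsub>free_ring\<^esub> = 1" "\<zero>\<^bsub>free_ring\<^esub> = 0"
  by (simp_all add: ring_of_type_algebra_def)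

lemma ring_free_ring: "ring (free_ring :: 'k::field free_alg ring)"
proof -
  have "\<exists>y. x + y = 0" for x :: "'k free_alg"
    using add.right_inverse by blast
  thus ?thesis
    unfolding ring_of_type_algebra_def using add.right_inverse
    by unfold_locales (auto simp: algebra_simps Units_def)
qed

lemma ideal_sjp_ideal: "ideal sjp_ideal free_ring"
  unfolding sjp_ideal_def by (rule ring.genideal_ideal[OF ring_free_ring]) simp

lemma ring_sjp: "ring sjp"
  unfolding sjp_def by (rule ideal.quotient_is_ring[OF ideal_sjp_ideal])

lemma sjp_class_hom: "sjp_class \<in> ring_hom free_ring sjp"
  using ideal.rcos_ring_hom[OF ideal_sjp_ideal] by (simp add: sjp_def sjp_class_def[abs_def])

lemma carrier_sjp: "carrier sjp = range sjp_class"
  by (auto simp: sjp_def FactRing_def A_RCOSETS_def' sjp_class_def)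

lemma sjp_class_elem: "f \<in> sjp_class h \<longleftrightarrow> f - h \<in> sjp_ideal"
proof -
  have "f \<in> sjp_class h \<longleftrightarrow> (\<exists>i\<in>sjp_ideal. f = i + h)"
    by (simp add: sjp_class_def a_r_coset_def')
  also have "\<dots> \<longleftrightarrow> f - h \<in> sjp_ideal"
    by (metis add_diff_cancel diff_add_cancel)
  finally show ?thesis .
qed

lemma sjp_relations:
  defines "x1 \<equiv> sjp_gen X1" and "x2 \<equiv> sjp_gen X2"
  defines "x21 \<equiv> x1 \<otimes>\<^bsub>sjp\<^esub> x2 \<oplus>\<^bsub>sjp\<^esub> x2 \<otimes>\<^bsub>sjp\<^esub> x1"
  shows "x1 \<otimes>\<^bsub>sjp\<^esub> x1 = \<zero>\<^bsub>sjp\<^esub>"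
    and "x2 \<otimes>\<^bsub>sjp\<^esub> x21 = x21 \<otimes>\<^bsub>sjp\<^esub> x2 \<oplus>\<^bsub>sjp\<^esub> x1 \<otimes>\<^bsub>sjp\<^esub> x21"
proof -
  have m: "sjp_class f \<otimes>\<^bsub>sjp\<^esub> sjp_class g = sjp_class (f * g)"
    and p: "sjp_class f \<oplus>\<^bsub>sjp\<^esub> sjp_class g = sjp_class (f + g)" for f g :: "'a free_alg"
    using ring_hom_mult[OF sjp_class_hom, of f g] ring_hom_add[OF sjp_class_hom, of f g] by simp_all
  have sub: "sjp_relators \<subseteq> (sjp_ideal :: 'a free_alg set)"
    unfolding sjp_ideal_def by (rule ring.genideal_self[OF ring_free_ring]) simp
  have eq: "sjp_class f = sjp_class g" if "f - g \<in> sjp_ideal" for f g :: "'a free_alg"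
  proof -
    interpret ideal "sjp_ideal :: 'a free_alg set" free_ring by (rule ideal_sjp_ideal)
    have "f \<in> sjp_class g" using that by (simp add: sjp_class_elem)
    thus ?thesis using a_repr_independence'[of f g] unfolding sjp_class_def by simp
  qed
  have z: "\<zero>\<^bsub>sjp\<^esub> = sjp_class (0 :: 'a free_alg)"
    by (simp add: sjp_def FactRing_def sjp_class_def a_r_coset_def')
  show "x1 \<otimes>\<^bsub>sjp\<^esub> x1 = \<zero>\<^bsub>sjp\<^esub>"
    unfolding z assms sjp_gen_def m p by (rule eq) (use sub in \<open>simp add: sjp_relators_def Let_def\<close>)
  show "x2 \<otimes>\<^bsub>sjp\<^esub> x21 = x21 \<otimes>\<^bsub>sjp\<^esub> x2 \<oplus>\<^bsub>sjp\<^esub> x1 \<otimes>\<^bsub>sjp\<^esub> x21"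
    unfolding assms sjp_gen_def m p by (rule eq) (use sub in \<open>simp add: sjp_relators_def Let_def\<close>)
qed

lemma vb_apply: "vb i j = (if j = i then 1 else 0)"
  by (simp add: vb_def)

lemma gen_act_X1:
  assumes "2 \<le> n"
  shows "gen_act n a X1 v j = (if j = 1 then v 2 else 0)"
proof -
  have "gen_act n a X1 v j = (\<Sum>i=1..n. if i = 2 then v 2 * vb 1 j else 0)"
    unfolding gen_act_def by (rule sum.cong) auto
  also have "\<dots> = v 2 * vb 1 j" using assms by (subst sum.delta) auto
  finally show ?thesis by (simp add: vb_apply)
qed

lemma gen_act_X2:
  assumes "2 \<le> n"
  shows "gen_act n a X2 v j =
    (if j = 1 then a * v 1
     else if j \<in> {2..n} then - a * v j + (if 3 \<le> j then v (j - 1) else 0) else 0)"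
proof -
  have "gen_act n a X2 v j = (\<Sum>i=1..n.
      (if i = j then v j * (if j = 1 then a else - a) else 0)
      + (if i = j - 1 then (if 3 \<le> j \<and> j \<le> n then v (j - 1) else 0) else 0))"
    unfolding gen_act_def by (rule sum.cong) (auto simp: vb_apply)
  also have "\<dots> = (if j \<in> {1..n} then v j * (if j = 1 then a else - a) else 0)
      + (if j - 1 \<in> {1..n} then (if 3 \<le> j \<and> j \<le> n then v (j - 1) else 0) else 0)"
    by (simp only: sum.distrib sum.delta finite_atLeastAtMost)
  finally show ?thesis using assms by auto
qed

lemma gen_act_linear:
  "gen_act n a g (\<lambda>i. v i + w i) = (\<lambda>j. gen_act n a g v j + gen_act n a g w j)"
  "gen_act n a g (\<lambda>i. c * v i) = (\<lambda>j. c * gen_act n a g v j)"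
  by (simp_all add: gen_act_def fun_eq_iff sum.distrib sum_distrib_left algebra_simps)

lemma word_act_linear:
  "word_act n a u (\<lambda>i. v i + w i) = (\<lambda>j. word_act n a u v j + word_act n a u w j)"
  "word_act n a u (\<lambda>i. c * v i) = (\<lambda>j. c * word_act n a u v j)"
proof -
  have "foldr (gen_act n a) us (\<lambda>i. v i + w i) =
      (\<lambda>j. foldr (gen_act n a) us v j + foldr (gen_act n a) us w j)" for us
    by (induction us) (simp_all add: gen_act_linear)
  thus "word_act n a u (\<lambda>i. v i + w i) = (\<lambda>j. word_act n a u v j + word_act n a u w j)"
    by (simp add: word_act_def)
  have "foldr (gen_act n a) us (\<lambda>i. c * v i) = (\<lambda>j. c * foldr (gen_act n a) us v j)" for us
    by (induction us) (simp_all add: gen_act_linear)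
  thus "word_act n a u (\<lambda>i. c * v i) = (\<lambda>j. c * word_act n a u v j)"
    by (simp add: word_act_def)
qed

lemma word_act_plus: "word_act n a (u + w) v = word_act n a u (word_act n a w v)"
  by (simp add: word_act_def plus_word_def)

lemma word_act_0 [simp]: "word_act n a 0 v = v"
  by (simp add: word_act_def zero_word_def)

lemma gen_act_closed:
  assumes "j \<notin> {1..n}"
  shows "gen_act n a g v j = 0"
  unfolding gen_act_def using assms by (intro sum.neutral) (cases g; auto simp: vb_apply)

lemma word_act_closed:
  assumes "\<And>i. i \<notin> {1..n} \<Longrightarrow> v i = 0" "j \<notin> {1..n}"
  shows "word_act n a w v j = 0"
proof -
  have "foldr (gen_act n a) us v j = 0" for us
    using assms(1)[OF assms(2)] gen_act_closed[OF assms(2)] by (cases us) simp_all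
  thus ?thesis by (simp add: word_act_def)
qed

lemma free_act_superset:
  assumes "finite S" "Poly_Mapping.keys f \<subseteq> S"
  shows "free_act n a f v j = (\<Sum>w\<in>S. Poly_Mapping.lookup f w * word_act n a w v j)"
  unfolding free_act_def
  by (rule sum.mono_neutral_left) (use assms in \<open>auto simp: in_keys_iff\<close>)

lemma free_act_add: "free_act n a (f + g) v = (\<lambda>j. free_act n a f v j + free_act n a g v j)"
proof
  fix j
  let ?S = "Poly_Mapping.keys f \<union> Poly_Mapping.keys g"
  have "Poly_Mapping.keys (f + g) \<subseteq> ?S" by (rule keys_add)
  thus "free_act n a (f + g) v j = free_act n a f v j + free_act n a g v j"
    by (simp add: free_act_superset[of ?S] lookup_add sum.distrib[symmetric] algebra_simps)
qed

lemma free_act_uminus: "free_act n a (- f) v = (\<lambda>j. - free_act n a f v j)"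
  by (simp add: free_act_def sum_negf fun_eq_iff)

lemma free_act_diff: "free_act n a (f - g) v = (\<lambda>j. free_act n a f v j - free_act n a g v j)"
  using free_act_add[of n a f "- g" v] by (simp add: free_act_uminus)

lemma free_act_0 [simp]: "free_act n a 0 v = (\<lambda>j. 0)"
  by (simp add: free_act_def)

lemma free_act_single [simp]:
  "free_act n a (Poly_Mapping.single w c) v = (\<lambda>j. c * word_act n a w v j)"
  by (cases "c = 0") (simp_all add: free_act_def fun_eq_iff)

lemma free_act_linear:
  "free_act n a f (\<lambda>i. v i + w i) = (\<lambda>j. free_act n a f v j + free_act n a f w j)"
  "free_act n a f (\<lambda>i. c * v i) = (\<lambda>j. c * free_act n a f v j)"
  by (simp_all add: free_act_def word_act_linear fun_eq_iff sum.distrib sum_distrib_left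
      algebra_simps)

lemma free_act_zero_vec [simp]: "free_act n a f (\<lambda>i. 0) = (\<lambda>j. 0)"
  using free_act_linear(2)[of n a f 0 "\<lambda>i. 0"] by simp

lemma free_alg_induct [case_names zero single_add]:
  assumes "P 0" "\<And>w c f. P f \<Longrightarrow> P (Poly_Mapping.single w c + f)"
  shows "P (f :: 'k::field free_alg)"
proof (induction f rule: update_induct)
  case const
  show ?case by (rule assms(1))
next
  case (update f w c)
  have "Poly_Mapping.update w c f = Poly_Mapping.single w c + f"
    using update(1) by (intro poly_mapping_eqI)
      (auto simp: lookup_update lookup_add lookup_single when_def in_keys_iff)
  with assms(2)[OF update(3)] show ?case by simp
qed

lemma free_act_mult: "free_act n a (f * g) v = free_act n a f (free_act n a g v)"
proof (induction f rule: free_alg_induct)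
  case zero
  show ?case by simp
next
  case (single_add w c f)
  have "free_act n a (Poly_Mapping.single w c * g) v
      = (\<lambda>j. c * word_act n a w (free_act n a g v) j)"
  proof (induction g rule: free_alg_induct)
    case zero
    show ?case using word_act_linear(2)[of n a w 0 "\<lambda>i. 0"] by simp
  next
    case (single_add u d g)
    thus ?case
      by (simp add: distrib_left free_act_add mult_single word_act_plus word_act_linear
          algebra_simps)
  qed
  with single_add show ?case by (simp add: distrib_right free_act_add)
qed

lemma free_act_gen: "free_act n a (free_gen g) v = gen_act n a g v"
  by (simp add: free_gen_def word_act_def)

lemma free_act_one: "free_act n a 1 v = v"
proof -
  have "free_act n a (Poly_Mapping.single 0 1) v = v" by (subst free_act_single) simp
  thus ?thesis by simp
qed

lemma free_act_closed: "v \<in> carrier (Va n a) \<Longrightarrow> free_act n a f v \<in> carrier (Va n a)"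
  using word_act_closed[of n v] by (simp add: Va_def free_act_def)

lemma free_act_ideal:
  assumes "2 \<le> n" "f \<in> sjp_ideal"
  shows "free_act n a f v = (\<lambda>j. 0)"
proof -
  define K where "K = {f. \<forall>v. free_act n a f v = (\<lambda>j. 0)}"
  interpret ring "free_ring :: 'a free_alg ring" by (rule ring_free_ring)
  have "ideal K free_ring"
  proof (rule idealI[OF ring_free_ring])
    show "subgroup K (add_monoid free_ring)"
    proof (rule add.subgroupI)
      show "K \<noteq> {}" unfolding K_def by (auto intro!: exI[of _ 0])
      fix f assume f: "f \<in> K"
      have "\<ominus>\<^bsub>free_ring\<^esub> f = - f" by (rule minus_equality) simp_all
      with f show "\<ominus>\<^bsub>free_ring\<^esub> f \<in> K" by (simp add: K_def free_act_uminus)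
    qed (auto simp: K_def free_act_add)
  qed (simp_all add: K_def free_act_mult)
  moreover have "sjp_relators \<subseteq> K"
  proof -
    have x21: "(\<lambda>j. gen_act n a X1 (gen_act n a X2 v) j + gen_act n a X2 (gen_act n a X1 v) j)
        = (\<lambda>j. 0)" for v
      using assms(1) by (auto simp: fun_eq_iff gen_act_X1 gen_act_X2)
    have z: "gen_act n a g (\<lambda>j. 0) = (\<lambda>j. 0)" for g
      by (simp add: gen_act_def)
    have x1: "gen_act n a X1 (gen_act n a X1 v) = (\<lambda>j. 0)" for v
      using assms(1) by (auto simp: fun_eq_iff gen_act_X1)
    show ?thesis
      by (simp add: sjp_relators_def K_def Let_def free_act_mult free_act_add free_act_diff
          free_act_gen x21 x1 z)
  qed
  ultimately have "sjp_ideal \<subseteq> K"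
    unfolding sjp_ideal_def by (rule genideal_minimal)
  thus ?thesis using assms(2) by (auto simp: K_def)
qed

lemma Va_smult_class:
  assumes "2 \<le> n"
  shows "sjp_class f \<odot>\<^bsub>Va n a\<^esub> v = free_act n a f v"
proof -
  have "free_act n a g v = free_act n a f v" if "g \<in> sjp_class f" for g
  proof -
    have "free_act n a (g - f) v = (\<lambda>j. 0)"
      using that assms by (intro free_act_ideal) (simp_all add: sjp_class_elem)
    thus ?thesis by (simp add: free_act_diff fun_eq_iff)
  qed
  moreover have "f \<in> sjp_class f"
    using additive_subgroup.zero_closed[OF ideal.axioms(1)[OF ideal_sjp_ideal]]
    by (simp add: sjp_class_elem)
  ultimately have "(\<lambda>g. free_act n a g v) ` sjp_class f = {free_act n a f v}" by blast
  thus ?thesis by (simp add: Va_def)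
qed

lemma Va_add [simp]: "v \<oplus>\<^bsub>Va n a\<^esub> w = (\<lambda>i. v i + w i)"
  and Va_zero [simp]: "\<zero>\<^bsub>Va n a\<^esub> = (\<lambda>i. 0)"
  by (simp_all add: Va_def)

lemma abelian_group_Va: "abelian_group (Va n a)"
proof (rule abelian_groupI)
  fix v assume "v \<in> carrier (Va n a)"
  thus "\<exists>w\<in>carrier (Va n a). w \<oplus>\<^bsub>Va n a\<^esub> v = \<zero>\<^bsub>Va n a\<^esub>"
    by (intro bexI[of _ "\<lambda>i. - v i"]) (auto simp: Va_def)
next
  fix v w :: "nat \<Rightarrow> 'a"
  show "v \<oplus>\<^bsub>Va n a\<^esub> w = w \<oplus>\<^bsub>Va n a\<^esub> v" by (simp add: add.commute)
qed (simp_all add: Va_def add.assoc)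

lemma left_module_Va:
  assumes "2 \<le> n"
  shows "left_module sjp (Va n a)"
proof (intro left_module.intro left_module_axioms.intro ring_sjp abelian_group_Va)
  have one: "\<one>\<^bsub>sjp\<^esub> = sjp_class 1" by (metis ring_hom_one[OF sjp_class_hom] free_ring_simps(4))
  show "\<one>\<^bsub>sjp\<^esub> \<odot>\<^bsub>Va n a\<^esub> v = v" for v
    by (simp add: one Va_smult_class[OF assms] free_act_one)
  fix x :: "'a free_alg set" and v assume "x \<in> carrier sjp" and v: "v \<in> carrier (Va n a)"
  then obtain f where f: "x = sjp_class f" by (auto simp: carrier_sjp)
  show "x \<odot>\<^bsub>Va n a\<^esub> v \<in> carrier (Va n a)"
    using v by (simp add: f Va_smult_class[OF assms] free_act_closed)
  show "x \<odot>\<^bsub>Va n a\<^esub> (v \<oplus>\<^bsub>Va n a\<^esub> w) = x \<odot>\<^bsub>Va n a\<^esub> v \<oplus>\<^bsub>Va n a\<^esub> x \<odot>\<^bsub>Va n a\<^esub> w" for w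
    by (simp add: f Va_smult_class[OF assms] free_act_linear)
  fix y :: "'a free_alg set" assume "y \<in> carrier sjp"
  then obtain g where g: "y = sjp_class g" by (auto simp: carrier_sjp)
  have m: "x \<otimes>\<^bsub>sjp\<^esub> y = sjp_class (f * g)" and p: "x \<oplus>\<^bsub>sjp\<^esub> y = sjp_class (f + g)"
    using ring_hom_mult[OF sjp_class_hom, of f g] ring_hom_add[OF sjp_class_hom, of f g]
    by (simp_all add: f g)
  show "(x \<otimes>\<^bsub>sjp\<^esub> y) \<odot>\<^bsub>Va n a\<^esub> v = x \<odot>\<^bsub>Va n a\<^esub> (y \<odot>\<^bsub>Va n a\<^esub> v)"
    unfolding m by (simp add: f g Va_smult_class[OF assms] free_act_mult)
  show "(x \<oplus>\<^bsub>sjp\<^esub> y) \<odot>\<^bsub>Va n a\<^esub> v = x \<odot>\<^bsub>Va n a\<^esub> v \<oplus>\<^bsub>Va n a\<^esub> y \<odot>\<^bsub>Va n a\<^esub> v"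
    unfolding p by (simp add: f g Va_smult_class[OF assms] free_act_add)
qed

lemma Va_smult_gen_basis:
  assumes "2 \<le> n" "i \<in> {1..n}"
  shows "sjp_gen g \<odot>\<^bsub>Va n a\<^esub> vb i = gen_on_basis n a g i"
proof -
  have "gen_act n a g (vb i) j = (\<Sum>k=1..n. if k = i then gen_on_basis n a g i j else 0)" for j
    unfolding gen_act_def by (rule sum.cong) (auto simp: vb_apply)
  also have "(\<Sum>k=1..n. if k = i then gen_on_basis n a g i j else 0) = gen_on_basis n a g i j" for j
    using assms(2) by simp
  finally show ?thesis
    by (simp add: sjp_gen_def Va_smult_class[OF assms(1)] free_act_gen fun_eq_iff)
qed

lemma Va_smult_scalar:
  assumes "2 \<le> n"
  shows "sjp_scalar c \<odot>\<^bsub>Va n a\<^esub> v = (\<lambda>i. c * v i)"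
  by (simp add: sjp_scalar_def Va_smult_class[OF assms])

lemma is_k_basis_Va:
  assumes "2 \<le> n"
  shows "is_k_basis (Va n a) n vb"
proof -
  interpret M: abelian_group "Va n a" by (rule abelian_group_Va)
  have vb: "vb i \<in> carrier (Va n a)" if "i \<in> {1..n}" for i
    using that by (auto simp: Va_def vb_apply)
  have cvb: "(\<lambda>j. c * vb i j) \<in> carrier (Va n a)" if "i \<in> {1..n}" for c i
    using that by (auto simp: Va_def vb_apply)
  have fs: "(\<Oplus>\<^bsub>Va n a\<^esub>i\<in>S. sjp_scalar (c i) \<odot>\<^bsub>Va n a\<^esub> vb i)
      = (\<lambda>j. if j \<in> S then c j else 0)" if "finite S" "S \<subseteq> {1..n}" for c S
    using that
  proof (induction S rule: finite_induct)
    case empty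
    show ?case by simp
  next
    case (insert i S)
    have "(\<Oplus>\<^bsub>Va n a\<^esub>i\<in>insert i S. sjp_scalar (c i) \<odot>\<^bsub>Va n a\<^esub> vb i)
      = (\<lambda>j. c i * vb i j) \<oplus>\<^bsub>Va n a\<^esub> (\<Oplus>\<^bsub>Va n a\<^esub>i\<in>S. sjp_scalar (c i) \<odot>\<^bsub>Va n a\<^esub> vb i)"
      using insert cvb by (subst M.finsum_insert) (auto simp: Va_smult_scalar[OF assms] Pi_iff)
    also have "\<dots> = (\<lambda>j. if j \<in> insert i S then c j else 0)"
    proof -
      have IH: "(\<Oplus>\<^bsub>Va n a\<^esub>i\<in>S. sjp_scalar (c i) \<odot>\<^bsub>Va n a\<^esub> vb i) = (\<lambda>j. if j \<in> S then c j else 0)"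
        using insert.IH insert.prems by simp
      show ?thesis
        unfolding IH Va_add using insert.hyps by (intro ext) (simp add: vb_apply)
    qed
    finally show ?case .
  qed
  have "\<exists>!c. c \<in> {1..n} \<rightarrow>\<^sub>E UNIV \<and>
       m = (\<Oplus>\<^bsub>Va n a\<^esub>i\<in>{1..n}. sjp_scalar (c i) \<odot>\<^bsub>Va n a\<^esub> vb i)"
    if m: "m \<in> carrier (Va n a)" for m
    unfolding fs[OF finite_atLeastAtMost order_refl]
  proof (rule ex1I[of _ "restrict m {1..n}"])
    have "m j = 0" if "j \<notin> {1..n}" for j
      using m that by (simp add: Va_def)
    hence "m = (\<lambda>j. if j \<in> {1..n} then restrict m {1..n} j else 0)"
      by (intro ext) simp
    thus "restrict m {1..n} \<in> {1..n} \<rightarrow>\<^sub>E UNIV \<and>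
        m = (\<lambda>j. if j \<in> {1..n} then restrict m {1..n} j else 0)"
      by (intro conjI restrict_PiE_iff[THEN iffD2] ballI UNIV_I)
  next
    fix c
    assume c: "c \<in> {1..n} \<rightarrow>\<^sub>E UNIV \<and> m = (\<lambda>j. if j \<in> {1..n} then c j else 0)"
    have "m j = c j" if "j \<in> {1..n}" for j
      using fun_cong[OF conjunct2[OF c], of j] unfolding if_P[OF that] .
    moreover have "c j = undefined" if "j \<notin> {1..n}" for j
      by (rule PiE_arb[OF conjunct1[OF c] that])
    ultimately show "c = restrict m {1..n}"
      by (intro ext) (simp add: restrict_def)
  qed
  thus ?thesis using vb by (auto simp: is_k_basis_def)
qed

end

theory Submission
  imports Defs
begin

text \<open>\<open>V_a\<close> is generated by any vector \<open>u\<close> with \<open>u 2 \<noteq> 0\<close>: applying \<open>x1\<close> gives a nonzero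
  multiple of \<open>v_1\<close>, and the vectors \<open>(x2 + a)^(k - 2) u\<close> are triangular with respect to
  \<open>v_2, \<dots>, v_n\<close> modulo \<open>v_1\<close>.  Hence every proper submodule lies in the hyperplane \<open>u 2 = 0\<close>,
  and two proper submodules cannot span \<open>V_a\<close>.\<close>

lemma carrier_Va: "carrier (Va n a) = {v. \<forall>i. i \<notin> {1..n} \<longrightarrow> v i = 0}"
  by (simp add: Va_def)

lemma submodule_Va_free_act:
  assumes "2 \<le> n" "submodule U sjp (Va n a)" "v \<in> U"
  shows "free_act n a f v \<in> U"
  using submodule.smult_closed[OF assms(2), of "sjp_class f" v] assms
  by (simp add: carrier_sjp Va_smult_class)

lemma submodule_Va_gen_act:
  assumes "2 \<le> n" "submodule U sjp (Va n a)" "v \<in> U"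
  shows "gen_act n a g v \<in> U"
  using submodule_Va_free_act[OF assms, of "free_gen g"] by (simp add: free_act_gen)

text \<open>Scalars act through constants of the free algebra, that is, multiples of the empty word,
  so a submodule over \<open>sjp\<close> is also a linear subspace.\<close>

lemma submodule_Va_scale:
  assumes "2 \<le> n" "submodule U sjp (Va n a)" "v \<in> U"
  shows "(\<lambda>i. c * v i) \<in> U"
  using submodule_Va_free_act[OF assms, of "Poly_Mapping.single 0 c"] by simp

lemma submodule_Va_add:
  assumes "submodule U sjp (Va n a)" "v \<in> U" "w \<in> U"
  shows "(\<lambda>i. v i + w i) \<in> U"
  using subgroup.m_closed[OF submodule.axioms(1)[OF assms(1)] assms(2,3)] by simp

lemma submodule_Va_subset:
  assumes "submodule U sjp (Va n a)"
  shows "U \<subseteq> carrier (Va n a)"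
  using subgroup.subset[OF submodule.axioms(1)[OF assms]] by simp

lemma submodule_Va_eq_carrier:
  assumes n: "2 \<le> n" and U: "submodule U sjp (Va n a)" and u: "u \<in> U" "u 2 \<noteq> 0"
  shows "U = carrier (Va n a)"
proof
  show "U \<subseteq> carrier (Va n a)" by (rule submodule_Va_subset[OF U])
  \<comment> \<open>\<open>X1\<close> sends \<open>u\<close> to \<open>u 2\<close> times
    \<open>vb 1\<close>, hence the factor \<open>c / u 2\<close>.\<close>
  have v1: "(\<lambda>j. c * vb 1 j) \<in> U" for c
  proof -
    have "(\<lambda>j. (c / u 2) * gen_act n a X1 u j) \<in> U"
      by (intro submodule_Va_scale[OF n U] submodule_Va_gen_act[OF n U] u)
    also have "(\<lambda>j. (c / u 2) * gen_act n a X1 u j) = (\<lambda>j. c * vb 1 j)"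
      using u(2) by (auto simp: gen_act_X1[OF n] vb_apply)
    finally show ?thesis .
  qed
  \<comment> \<open>The witness is \<open>(x2 + a)^(k - 2) u\<close>; its coordinate 1 is left free,
    since multiples of \<open>vb 1\<close> already lie in \<open>U\<close>.\<close>
  have lead: "\<exists>t\<in>U. t k = u 2 \<and> (\<forall>j. 2 \<le> j \<longrightarrow> j < k \<longrightarrow> t j = 0)" if "2 \<le> k" "k \<le> n" for k
    using that
  proof (induction k rule: dec_induct)
    case base
    show ?case using u by (intro bexI[of _ u]) auto
  next
    case (step k)
    then obtain t where t: "t \<in> U" "t k = u 2" "\<And>j. 2 \<le> j \<Longrightarrow> j < k \<Longrightarrow> t j = 0"
      by auto
    \<comment> \<open>Adding \<open>a\<close> cancels the diagonal entry \<open>- a\<close> on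
      coordinates 2 to n, so what remains there is a shift up by one. Coordinate 1 never enters
      coordinate 2.\<close>
    let ?t = "\<lambda>j. gen_act n a X2 t j + a * t j"
    have "?t \<in> U"
      by (intro submodule_Va_add[OF U] submodule_Va_scale[OF n U] submodule_Va_gen_act[OF n U] t)
    moreover have "?t (Suc k) = u 2"
      using step.hyps step.prems t(2) by (simp add: gen_act_X2[OF n])
    moreover have "?t j = 0" if "2 \<le> j" "j < Suc k" for j
      using step.prems that t(3)[of "j - 1"] by (auto simp: gen_act_X2[OF n])
    ultimately show ?case by (intro bexI[of _ ?t]) auto
  qed
  \<comment> \<open>Back substitution, by descending induction on \<open>k\<close>: at
    \<open>Suc n\<close> only multiples of \<open>vb 1\<close> remain, and at 2 the vanishing
    condition is empty.\<close>
  have "\<forall>v\<in>carrier (Va n a). (\<forall>j. 2 \<le> j \<longrightarrow> j < k \<longrightarrow> v j = 0) \<longrightarrow> v \<in> U"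
    if "2 \<le> k" "k \<le> Suc n" for k
    using that(2,1)
  proof (induction k rule: inc_induct)
    case base
    show ?case
    proof (intro ballI impI)
      fix v assume v: "v \<in> carrier (Va n a)" "\<forall>j. 2 \<le> j \<longrightarrow> j < Suc n \<longrightarrow> v j = 0"
      have "v j = v 1 * vb 1 j" for j
      proof (cases "j = 1")
        case False
        hence "v j = 0" using v by (cases "j \<in> {1..n}") (auto simp: carrier_Va)
        with False show ?thesis by (simp add: vb_apply)
      qed (simp add: vb_apply)
      hence "v = (\<lambda>j. v 1 * vb 1 j)" by blast
      with v1[of "v 1"] show "v \<in> U" by simp
    qed
  next
    case (step k)
    show ?case
    proof (intro ballI impI)
      fix v assume v: "v \<in> carrier (Va n a)" "\<forall>j. 2 \<le> j \<longrightarrow> j < k \<longrightarrow> v j = 0"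
      obtain t where t: "t \<in> U" "t k = u 2" "\<And>j. 2 \<le> j \<Longrightarrow> j < k \<Longrightarrow> t j = 0"
        using lead[of k] step by auto
      \<comment> \<open>As \<open>t k = u 2\<close>, subtracting \<open>c * t\<close> clears
        coordinate \<open>k\<close> and keeps the earlier zeros from 2 on.\<close>
      define c where "c = v k / u 2"
      let ?w = "\<lambda>j. v j + - c * t j"
      have "?w \<in> carrier (Va n a)"
        using v(1) t(1) submodule_Va_subset[OF U] by (auto simp: carrier_Va)
      moreover have "?w j = 0" if "2 \<le> j" "j < Suc k" for j
        using that v(2) t(2,3) u(2) by (cases "j = k") (auto simp: c_def)
      ultimately have w: "?w \<in> U" using step by auto
      have "(\<lambda>j. ?w j + c * t j) \<in> U"
        by (intro submodule_Va_add[OF U] submodule_Va_scale[OF n U] w t)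
      thus "v \<in> U" by simp
    qed
  qed
  from this[of 2] n show "carrier (Va n a) \<subseteq> U" by auto
qed

lemma indecomposable_Va:
  assumes n: "2 \<le> n"
  shows "indecomposable_module sjp (Va n a)"
  unfolding indecomposable_module_def
proof (intro conjI allI impI)
  have vb: "vb 2 \<in> carrier (Va n a)" using n by (auto simp: carrier_Va vb_apply)
  have "vb 2 2 \<noteq> (0 :: 'a)" by (simp add: vb_apply)
  with vb show "carrier (Va n a) \<noteq> {\<zero>\<^bsub>Va n a\<^esub>}" by fastforce
  fix U W
  assume U: "submodule U sjp (Va n a)" and W: "submodule W sjp (Va n a)"
    and sum: "U <+>\<^bsub>Va n a\<^esub> W = carrier (Va n a)" and int: "U \<inter> W = {\<zero>\<^bsub>Va n a\<^esub>}"
  have "vb 2 \<in> U <+>\<^bsub>Va n a\<^esub> W" using vb sum by simp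
  then obtain u w where uw: "u \<in> U" "w \<in> W" "vb 2 = (\<lambda>i. u i + w i)"
    by (auto simp: set_add_def')
  \<comment> \<open>One summand of \<open>vb 2\<close> must leave the hyperplane of vanishing second
    coordinate, so its submodule is everything; the other one then equals the zero
    intersection.\<close>
  have "u 2 + w 2 = 1" using fun_cong[OF uw(3), of 2] by (simp add: vb_apply)
  hence "u 2 \<noteq> 0 \<or> w 2 \<noteq> 0" by auto
  hence "U = carrier (Va n a) \<or> W = carrier (Va n a)"
    using submodule_Va_eq_carrier[OF n U uw(1)] submodule_Va_eq_carrier[OF n W uw(2)] by blast
  with int submodule_Va_subset[OF U] submodule_Va_subset[OF W]
  show "U = {\<zero>\<^bsub>Va n a\<^esub>} \<or> W = {\<zero>\<^bsub>Va n a\<^esub>}" by blast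
qed

theorem theorem4p3:
  fixes n :: nat and a :: "'k :: {alg_closed_field, field_char_0}"
  assumes "n \<ge> 2" and "a \<noteq> 0"
  shows "left_module sjp (Va n a) \<and> is_k_basis (Va n a) n vb \<and>
         indecomposable_module sjp (Va n a)"
  using assms(1) by (intro conjI left_module_Va is_k_basis_Va indecomposable_Va)

end
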